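(* Let $k\ge0$. The generating function $A^{(k)}(x)=\sum_{n\ge0}a^{(k)}_n x^n$ for the numbers $a^{(k)}_n=|\mathcal{A}^{(k)}_n|$ is given by the finite continued fraction $$A^{(k)}(x)=\cfrac{1}{1-x-\cfrac{x^2}{1-3x-\cfrac{4x^2}{1-5x-\cfrac{9x^2}{\ddots\; 1-(2k-1)x-\cfrac{k^2x^2}{1-(2k+1)x}}}}}.$$ That is, $A^{(k)}(x)=1/C_0(x)$, where $C_k(x)=1-(2k+1)x$ and $C_h(x)=1-(2h+1)x-\dfrac{(h+1)^2x^2}{C_{h+1}(x)}$ for $0\le h<k$.
   Context: $\mathcal{S}_n$ is the set of permutations of $\{1,\dots,n\}$. For $k\ge0$ and $n\ge1$, $$\mathcal{A}^{(k)}_n=\{\pi\in\mathcal{S}_n : |\{j : j\le i\text{ and }\pi(j)>i\}|\le k\text{ for every } i\in\{1,\dots,n\}\},$$ $a^{(k)}_n=|\mathcal{A}^{(k)}_n|$, and $a^{(k)}_0=1$ by convention. The identity is one of formal power series in $x$. *)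

theory Defs
  imports "HOL-Computational_Algebra.Formal_Power_Series" "HOL-Combinatorics.Permutations"
begin

definition bounded_excedance_perms :: "nat \<Rightarrow> nat \<Rightarrow> (nat \<Rightarrow> nat) set" where
  "bounded_excedance_perms k n =
     {\<pi>. \<pi> permutes {1..n} \<and>
          (\<forall>i\<in>{1..n}. card {j \<in> {1..n}. j \<le> i \<and> \<pi> j > i} \<le> k)}"

text \<open>The case \<open>n = 0\<close> is the convention \<open>a_num k 0 = 1\<close>.\<close>

definition a_num :: "nat \<Rightarrow> nat \<Rightarrow> nat" where
  "a_num k n = (if n = 0 then 1 else card (bounded_excedance_perms k n))"

definition A_gf :: "nat \<Rightarrow> rat fps" where
  "A_gf k = Abs_fps (\<lambda>n. of_nat (a_num k n))"

text \<open>The tail of the continued fraction that starts at level \<open>h\<close>, for \<open>h \<le> k\<close>. Arguments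
  \<open>h > k\<close> never arise from \<open>cf_tail k 0\<close>. Every tail has constant coefficient 1, so the quotients
  of power series below are quotients by units.\<close>

function cf_tail :: "nat \<Rightarrow> nat \<Rightarrow> rat fps" where
  "cf_tail k h =
     (if h < k
      then 1 - of_nat (2 * h + 1) * fps_X - of_nat ((h + 1)\<^sup>2) * fps_X\<^sup>2 / cf_tail k (h + 1)
      else 1 - of_nat (2 * h + 1) * fps_X)"
  by auto
termination by (relation "measure (\<lambda>(k, h). k - h)") auto

declare cf_tail.simps [simp del]

end

theory Submission
  imports Defs
begin

text \<open>Build a permutation of \<open>{1..n}\<close> by restricting it to \<open>{1..i}\<close> for \<open>i = 0, \<dots>, n\<close>. The
  restriction is a partial injection whose number \<open>h\<close> of unmatched points is the excedance
  count at \<open>i\<close>. Adding the point \<open>i + 1\<close> raises \<open>h\<close> by one in one way, keeps it in \<open>2h + 1\<close>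
  ways and lowers it by one in \<open>h\<^sup>2\<close> ways, so these partial injections are counted by weighted
  Motzkin paths of height at most \<open>k\<close>. If \<open>W\<^sub>h\<close> is the generating function of the paths ending
  at height \<open>h\<close>, then downward induction gives \<open>C\<^sub>h W\<^sub>h = x W\<^sub>h\<^sub>-\<^sub>1\<close> for \<open>h > 0\<close> and
  \<open>C\<^sub>0 W\<^sub>0 = 1\<close>.\<close>

text \<open>A partial injection is represented by its graph; \<open>h\<close> is the number of points of
  \<open>{1..n}\<close> without an image.\<close>

definition partial_injs :: "nat \<Rightarrow> nat \<Rightarrow> nat \<Rightarrow> (nat \<times> nat) set set" where
  "partial_injs k n h =
     {R. R \<subseteq> {1..n} \<times> {1..n} \<and> inj_on fst R \<and> inj_on snd R \<and> card R + h = n \<and>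
         (\<forall>i\<le>n. i \<le> card (R \<inter> {1..i} \<times> {1..i}) + k)}"

lemma partial_injs_subset: "R \<in> partial_injs k n h \<Longrightarrow> R \<subseteq> {1..n} \<times> {1..n}"
  by (simp add: partial_injs_def)

lemma finite_mem_partial_injs: "R \<in> partial_injs k n h \<Longrightarrow> finite R"
  using finite_subset[of R "{1..n} \<times> {1..n}"] by (simp add: partial_injs_def)

lemma finite_partial_injs: "finite (partial_injs k n h)"
  by (rule finite_subset[of _ "Pow ({1..n} \<times> {1..n})"]) (auto simp: partial_injs_def)

text \<open>The prefix condition at \<open>i\<close> bounds by \<open>k\<close> the number of points
  of \<open>{1..i}\<close> without an image in \<open>{1..i}\<close>. At \<open>i = n\<close> the
  restriction is all of \<open>R\<close>.\<close>

lemma partial_injs_height: "R \<in> partial_injs k n h \<Longrightarrow> h \<le> k"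
proof -
  assume R: "R \<in> partial_injs k n h"
  then have "n \<le> card (R \<inter> {1..n} \<times> {1..n}) + k" "card R + h = n"
    by (auto simp: partial_injs_def)
  moreover have "R \<inter> {1..n} \<times> {1..n} = R"
    using partial_injs_subset[OF R] by blast
  ultimately show ?thesis by simp
qed

lemma partial_injs_empty_above: "k < h \<Longrightarrow> partial_injs k n h = {}"
  using partial_injs_height by fastforce

lemma partial_injs_0: "partial_injs k 0 h = (if h = 0 then {{}} else {})"
  by (auto simp: partial_injs_def)

text \<open>Both projections are injective on \<open>R\<close>, so points without an image and
  points without a preimage are equally many. These are the possible partners of a new
  point.\<close>

lemma partial_injs_deficit:
  assumes "R \<in> partial_injs k n h"
  shows "card ({1..n} - fst ` R) = h" "card ({1..n} - snd ` R) = h"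
proof -
  have "card (fst ` R) = card R" "card (snd ` R) = card R" "card R + h = n"
    using assms by (auto simp: partial_injs_def card_image)
  moreover have "fst ` R \<subseteq> {1..n}" "snd ` R \<subseteq> {1..n}"
    using partial_injs_subset[OF assms] by auto
  ultimately show "card ({1..n} - fst ` R) = h" "card ({1..n} - snd ` R) = h"
    by (auto simp: card_Diff_subset finite_mem_partial_injs[OF assms])
qed

section \<open>Adding the point \<open>Suc n\<close>\<close>

text \<open>Every pair of \<open>E\<close> involves \<open>Suc n\<close>, so the prefix conditions
  up to \<open>n\<close> see only \<open>R\<close>, and the one at \<open>Suc n\<close> amounts to
  \<open>h \<le> k\<close>. By \<open>card E + h = Suc h'\<close>, zero, one or two new pairs raise,
  keep or lower the height.\<close>

lemma partial_injs_Suc_iff: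
  assumes R: "R \<subseteq> {1..n} \<times> {1..n}"
    and E: "E \<subseteq> {1..Suc n} \<times> {1..Suc n} - {1..n} \<times> {1..n}"
  shows "R \<union> E \<in> partial_injs k (Suc n) h \<longleftrightarrow>
     h \<le> k \<and> inj_on fst (R \<union> E) \<and> inj_on snd (R \<union> E) \<and>
     (\<exists>h'. R \<in> partial_injs k n h' \<and> card E + h = Suc h')"
proof -
  have fin: "finite R" "finite E"
    using finite_subset[OF R] finite_subset[OF E] by auto
  have card: "card (R \<union> E) = card R + card E"
    using fin R E by (intro card_Un_disjoint) auto
  have pre: "(R \<union> E) \<inter> {1..i} \<times> {1..i} = R \<inter> {1..i} \<times> {1..i}" if "i \<le> n" for i
    using E that by force
  have full: "(R \<union> E) \<inter> {1..Suc n} \<times> {1..Suc n} = R \<union> E"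
    using R E by force
  have sub: "R \<union> E \<subseteq> {1..Suc n} \<times> {1..Suc n}"
    using R E by force
  have cardle: "card R \<le> n" if "inj_on fst R"
  proof -
    have "card (fst ` R) \<le> card {1..n}" using R by (intro card_mono) auto
    then show ?thesis using that by (simp add: card_image)
  qed
  have pres: "(\<forall>i\<le>Suc n. i \<le> card ((R \<union> E) \<inter> {1..i} \<times> {1..i}) + k) \<longleftrightarrow>
      h \<le> k \<and> (\<forall>i\<le>n. i \<le> card (R \<inter> {1..i} \<times> {1..i}) + k)"
    if "card (R \<union> E) + h = Suc n"
  proof -
    have "Suc n \<le> card (R \<union> E) + k \<longleftrightarrow> h \<le> k" using that by linarith
    then show ?thesis using pre full by (metis le_Suc_eq)
  qed
  show ?thesis (is "?L \<longleftrightarrow> ?M")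
  proof
    assume L: ?L
    then have inj: "inj_on fst (R \<union> E)" "inj_on snd (R \<union> E)" and c: "card (R \<union> E) + h = Suc n"
      and "\<forall>i\<le>Suc n. i \<le> card ((R \<union> E) \<inter> {1..i} \<times> {1..i}) + k"
      by (simp_all add: partial_injs_def)
    then have p: "h \<le> k" "\<forall>i\<le>n. i \<le> card (R \<inter> {1..i} \<times> {1..i}) + k"
      using pres by blast+
    have inj': "inj_on fst R" "inj_on snd R" using inj by (simp_all add: inj_on_Un)
    \<comment> \<open>\<open>R\<close> determines its height; the subtraction is exact, since
      injectivity of \<open>fst\<close> gives \<open>card R \<le> n\<close>.\<close>
    have "R \<in> partial_injs k n (n - card R)"
      using R inj' p cardle unfolding partial_injs_def by simp
    moreover have "card E + h = Suc (n - card R)"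
      using c card cardle[OF inj'(1)] by linarith
    ultimately show ?M using inj p by blast
  next
    assume ?M
    then obtain h' where M: "h \<le> k" "inj_on fst (R \<union> E)" "inj_on snd (R \<union> E)"
      "R \<in> partial_injs k n h'" "card E + h = Suc h'" by blast
    then have "card (R \<union> E) + h = Suc n" unfolding card by (simp add: partial_injs_def)
    then show ?L using M sub pres unfolding partial_injs_def by blast
  qed
qed

text \<open>A partial injection of \<open>{1..n+1}\<close> is classified by whether \<open>n + 1\<close> has an image and a
  preimage.\<close>

lemma partial_injs_Suc:
  assumes "h \<le> k"
  shows "partial_injs k (Suc n) h =
      (if h = 0 then {} else partial_injs k n (h - 1)) \<union>
      insert (Suc n, Suc n) ` partial_injs k n h \<union>
      (\<lambda>(R, b). insert (Suc n, b) R) ` (SIGMA R:partial_injs k n h. {1..n} - snd ` R) \<union>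
      (\<lambda>(R, a). insert (a, Suc n) R) ` (SIGMA R:partial_injs k n h. {1..n} - fst ` R) \<union>
      (\<lambda>(R, a, b). insert (a, Suc n) (insert (Suc n, b) R)) `
        (SIGMA R:partial_injs k n (Suc h). ({1..n} - fst ` R) \<times> ({1..n} - snd ` R))"
    (is "?L = ?A \<union> ?B \<union> ?C \<union> ?D \<union> ?E")
proof
  let ?N = "Suc n"
  \<comment> \<open>With \<open>E\<close> of size 0, 1 or 2 the old height is \<open>h - 1\<close>,
    \<open>h\<close> or \<open>h + 1\<close>. The first case needs \<open>h > 0\<close>, since a
    rise cannot end at height 0.\<close>
  have ext: "R \<union> E \<in> ?L"
    if "R \<in> partial_injs k n h'" "E \<subseteq> {1..?N} \<times> {1..?N} - {1..n} \<times> {1..n}"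
      "inj_on fst (R \<union> E)" "inj_on snd (R \<union> E)" "card E + h = Suc h'" for R E h'
    using partial_injs_Suc_iff[OF partial_injs_subset[OF that(1)] that(2)] assms that by blast
  have inj: "inj_on fst R" "inj_on snd R" if "R \<in> partial_injs k n h'" for R h'
    using that by (simp_all add: partial_injs_def)
  have old: "(a, ?N) \<notin> R" "(?N, b) \<notin> R" if "R \<in> partial_injs k n h'" for R a b h'
    using partial_injs_subset[OF that] by auto
  show "?A \<union> ?B \<union> ?C \<union> ?D \<union> ?E \<subseteq> ?L"
  proof (intro Un_least)
    show "?A \<subseteq> ?L"
      using ext[of _ "h - 1" "{}"] inj by auto
    show "?B \<subseteq> ?L"
    proof clarify
      fix R assume R: "R \<in> partial_injs k n h"
      have "R \<union> {(?N, ?N)} \<in> ?L"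
        by (rule ext[OF R]) (use inj[OF R] old[OF R] in \<open>auto simp: inj_on_Un\<close>)
      then show "insert (?N, ?N) R \<in> ?L" by simp
    qed
    show "?C \<subseteq> ?L"
    proof clarify
      fix R b assume R: "R \<in> partial_injs k n h" and b: "b \<in> {1..n}" "b \<notin> snd ` R"
      have "R \<union> {(?N, b)} \<in> ?L"
        by (rule ext[OF R]) (use inj[OF R] old[OF R] b in \<open>auto simp: inj_on_Un\<close>)
      then show "insert (?N, b) R \<in> ?L" by simp
    qed
    show "?D \<subseteq> ?L"
    proof clarify
      fix R a assume R: "R \<in> partial_injs k n h" and a: "a \<in> {1..n}" "a \<notin> fst ` R"
      have "R \<union> {(a, ?N)} \<in> ?L"
        by (rule ext[OF R]) (use inj[OF R] old[OF R] a in \<open>auto simp: inj_on_Un\<close>)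
      then show "insert (a, ?N) R \<in> ?L" by simp
    qed
    show "?E \<subseteq> ?L"
    proof clarify
      fix R a b assume R: "R \<in> partial_injs k n (Suc h)"
        and a: "a \<in> {1..n}" "a \<notin> fst ` R" and b: "b \<in> {1..n}" "b \<notin> snd ` R"
      have "R \<union> {(a, ?N), (?N, b)} \<in> ?L"
        by (rule ext[OF R]) (use inj[OF R] old[OF R] a b in \<open>auto simp: inj_on_Un\<close>)
      then show "insert (a, ?N) (insert (?N, b) R) \<in> ?L" by simp
    qed
  qed
  show "?L \<subseteq> ?A \<union> ?B \<union> ?C \<union> ?D \<union> ?E"
  proof
    fix S assume S: "S \<in> ?L"
    define R where "R = S \<inter> {1..n} \<times> {1..n}"
    define E where "E = S - {1..n} \<times> {1..n}"
    have SRE: "S = R \<union> E" by (auto simp: R_def E_def)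
    have Esub: "E \<subseteq> {1..?N} \<times> {1..?N} - {1..n} \<times> {1..n}"
      using partial_injs_subset[OF S] by (auto simp: E_def)
    have "R \<subseteq> {1..n} \<times> {1..n}" by (simp add: R_def)
    from partial_injs_Suc_iff[OF this Esub, of k h] S SRE
    obtain h' where injS: "inj_on fst S" "inj_on snd S"
      and R: "R \<in> partial_injs k n h'" and h': "card E + h = Suc h'" by auto
    have fstD: "b = b'" if "(a, b) \<in> S" "(a, b') \<in> S" for a b b'
      using inj_onD[OF injS(1), of "(a, b)" "(a, b')"] that by simp
    have sndD: "a = a'" if "(a, b) \<in> S" "(a', b) \<in> S" for a a' b
      using inj_onD[OF injS(2), of "(a, b)" "(a', b)"] that by simp
    have E_iff: "(x, y) \<in> E \<longleftrightarrow> (x, y) \<in> S \<and> (x = ?N \<or> y = ?N)" for x y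
      using partial_injs_subset[OF S] by (auto simp: E_def)
    \<comment> \<open>In \<open>R\<close> the image of \<open>a\<close> would be at most
      \<open>n\<close>, while injectivity of \<open>fst\<close> on \<open>S\<close> makes
      \<open>Suc n\<close> its only image.\<close>
    have freefst: "a \<notin> fst ` R" if "(a, ?N) \<in> S" for a
      using that fstD by (force simp: R_def)
    have freesnd: "b \<notin> snd ` R" if "(?N, b) \<in> S" for b
      using that sndD by (force simp: R_def)
    have range: "x \<in> {1..?N}" "y \<in> {1..?N}" if "(x, y) \<in> S" for x y
      using partial_injs_subset[OF S] that by auto
    show "S \<in> ?A \<union> ?B \<union> ?C \<union> ?D \<union> ?E"
    proof (cases "\<exists>b. (?N, b) \<in> S")
      case True
      then obtain b where b: "(?N, b) \<in> S" by blast
      show ?thesis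
      proof (cases "\<exists>a. (a, ?N) \<in> S")
        case True
        then obtain a where a: "(a, ?N) \<in> S" by blast
        show ?thesis
        proof (cases "a = ?N")
          case True
          then have "E = {(?N, ?N)}" using a fstD sndD E_iff by (auto simp: set_eq_iff; metis)
          then show ?thesis using R h' SRE by auto
        next
          case False
          \<comment> \<open>Otherwise \<open>Suc n\<close> would have two preimages,
            \<open>a\<close> and itself.\<close>
          then have "b \<noteq> ?N" using a b sndD by blast
          have "E = {(a, ?N), (?N, b)}" using a b fstD sndD E_iff by (auto simp: set_eq_iff; metis)
          moreover from this have "R \<in> partial_injs k n (Suc h)" using R h' False by auto
          moreover have "a \<in> {1..n} - fst ` R" "b \<in> {1..n} - snd ` R"
            using freefst[OF a] freesnd[OF b] range[OF a] range[OF b] False \<open>b \<noteq> ?N\<close> by auto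
          ultimately have "S \<in> ?E"
            unfolding SRE by (intro image_eqI[of _ _ "(R, a, b)"]) auto
          then show ?thesis by blast
        qed
      next
        case False
        then have "b \<noteq> ?N" using b by blast
        have "E = {(?N, b)}" using False b fstD E_iff by (auto simp: set_eq_iff; metis)
        moreover from this have "R \<in> partial_injs k n h" using R h' by auto
        moreover have "b \<in> {1..n} - snd ` R"
          using freesnd[OF b] range[OF b] \<open>b \<noteq> ?N\<close> by auto
        ultimately have "S \<in> ?C"
          unfolding SRE by (intro image_eqI[of _ _ "(R, b)"]) auto
        then show ?thesis by blast
      qed
    next
      case noimage: False
      show ?thesis
      proof (cases "\<exists>a. (a, ?N) \<in> S")
        case True
        then obtain a where a: "(a, ?N) \<in> S" by blast
        then have "a \<noteq> ?N" using noimage by blast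
        have "E = {(a, ?N)}" using noimage a sndD E_iff by (auto simp: set_eq_iff; metis)
        moreover from this have "R \<in> partial_injs k n h" using R h' by auto
        moreover have "a \<in> {1..n} - fst ` R"
          using freefst[OF a] range[OF a] \<open>a \<noteq> ?N\<close> by auto
        ultimately have "S \<in> ?D"
          unfolding SRE by (intro image_eqI[of _ _ "(R, a)"]) auto
        then show ?thesis by blast
      next
        case False
        then have "E = {}" using noimage E_iff by auto
        then show ?thesis using R h' SRE by auto
      qed
    qed
  qed
qed

section \<open>Counting the one-point extensions\<close>

text \<open>Three tests separate the five classes of extensions: whether the new point has an image
  (\<open>P\<close>), whether it has a preimage (\<open>Q\<close>) and, if both, whether it is fixed
  (\<open>T\<close>).\<close>

lemma card_Un_five:
  assumes fin: "finite A" "finite B" "finite C" "finite D" "finite E"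
    and A: "\<And>x. x \<in> A \<Longrightarrow> \<not> P x \<and> \<not> Q x"
    and B: "\<And>x. x \<in> B \<Longrightarrow> P x \<and> Q x \<and> T x"
    and C: "\<And>x. x \<in> C \<Longrightarrow> P x \<and> \<not> Q x"
    and D: "\<And>x. x \<in> D \<Longrightarrow> \<not> P x \<and> Q x"
    and E: "\<And>x. x \<in> E \<Longrightarrow> P x \<and> Q x \<and> \<not> T x"
  shows "card (A \<union> B \<union> C \<union> D \<union> E) = card A + card B + card C + card D + card E"
proof -
  have "A \<inter> B = {}" "(A \<union> B) \<inter> C = {}" "(A \<union> B \<union> C) \<inter> D = {}" "(A \<union> B \<union> C \<union> D) \<inter> E = {}"
    using A B C D E by blast+
  then show ?thesis using fin by (simp add: card_Un_disjoint)
qed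

text \<open>The weight \<open>2 * h + 1\<close> counts one way to fix \<open>Suc n\<close>,
  \<open>h\<close> ways to give it only an image and \<open>h\<close> ways to give it only a
  preimage. A fall starts at height \<open>h + 1\<close>, where image and preimage are chosen
  independently among \<open>h + 1\<close> points each.\<close>

lemma card_partial_injs_Suc:
  assumes "h \<le> k"
  shows "card (partial_injs k (Suc n) h) =
      (if h = 0 then 0 else card (partial_injs k n (h - 1))) +
      (2 * h + 1) * card (partial_injs k n h) + (h + 1)\<^sup>2 * card (partial_injs k n (Suc h))"
proof -
  let ?N = "Suc n"
  let ?A = "if h = 0 then {} else partial_injs k n (h - 1)"
  let ?B = "insert (?N, ?N) ` partial_injs k n h"
  let ?SC = "SIGMA R:partial_injs k n h. {1..n} - snd ` R"
  let ?SD = "SIGMA R:partial_injs k n h. {1..n} - fst ` R"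
  let ?SE = "SIGMA R:partial_injs k n (Suc h). ({1..n} - fst ` R) \<times> ({1..n} - snd ` R)"
  let ?C = "(\<lambda>(R, b). insert (?N, b) R) ` ?SC"
  let ?D = "(\<lambda>(R, a). insert (a, ?N) R) ` ?SD"
  let ?E = "(\<lambda>(R, a, b). insert (a, ?N) (insert (?N, b) R)) ` ?SE"
  have old: "(a, ?N) \<notin> R" "(?N, b) \<notin> R" if "R \<in> partial_injs k n h'" for R a b h'
    using partial_injs_subset[OF that] by auto
  have finS: "finite ?SC" "finite ?SD" "finite ?SE"
    by (auto intro!: finite_SigmaI finite_partial_injs)
  then have fin: "finite ?A" "finite ?B" "finite ?C" "finite ?D" "finite ?E"
    by (auto intro: finite_partial_injs)
  have cB: "card ?B = card (partial_injs k n h)"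
    using old by (intro card_image inj_onI) (metis insert_ident)
  \<comment> \<open>Restricting to \<open>{1..n}\<close> recovers the old relation, which is one
    half of each injectivity proof below. Taking \<open>p = q\<close> covers a single new
    pair.\<close>
  have restr: "R = insert p (insert q R) \<inter> {1..n} \<times> {1..n}"
    if "R \<in> partial_injs k n h'" "p \<notin> {1..n} \<times> {1..n}" "q \<notin> {1..n} \<times> {1..n}" for R p q h'
    using partial_injs_subset[OF that(1)] that(2,3) by blast
  have "inj_on (\<lambda>(R, b). insert (?N, b) R) ?SC"
  proof (rule inj_onI, clarify)
    fix R b R' b'
    assume R: "R \<in> partial_injs k n h" "R' \<in> partial_injs k n h"
      and eq: "insert (?N, b) R = insert (?N, b') R'"
    have "b = b'" using eq old[OF R(1)] old[OF R(2)] by blast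
    moreover have "R = R'"
      using restr[OF R(1), of "(?N, b)" "(?N, b)"] restr[OF R(2), of "(?N, b')" "(?N, b')"] eq by simp
    ultimately show "R = R' \<and> b = b'" by simp
  qed
  then have "card ?C = card ?SC" by (rule card_image)
  also have "\<dots> = h * card (partial_injs k n h)"
    by (subst card_SigmaI) (auto simp: finite_partial_injs partial_injs_deficit simp del: One_nat_def)
  finally have cC: "card ?C = h * card (partial_injs k n h)" .
  have "inj_on (\<lambda>(R, a). insert (a, ?N) R) ?SD"
  proof (rule inj_onI, clarify)
    fix R b R' b'
    assume R: "R \<in> partial_injs k n h" "R' \<in> partial_injs k n h"
      and eq: "insert (b, ?N) R = insert (b', ?N) R'"
    have "b = b'" using eq old[OF R(1)] old[OF R(2)] by blast
    moreover have "R = R'"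
      using restr[OF R(1), of "(b, ?N)" "(b, ?N)"] restr[OF R(2), of "(b', ?N)" "(b', ?N)"] eq by simp
    ultimately show "R = R' \<and> b = b'" by simp
  qed
  then have "card ?D = card ?SD" by (rule card_image)
  also have "\<dots> = h * card (partial_injs k n h)"
    by (subst card_SigmaI) (auto simp: finite_partial_injs partial_injs_deficit simp del: One_nat_def)
  finally have cD: "card ?D = h * card (partial_injs k n h)" .
  have "inj_on (\<lambda>(R, a, b). insert (a, ?N) (insert (?N, b) R)) ?SE"
  proof (rule inj_onI)
    fix p q
    assume pq: "p \<in> ?SE" "q \<in> ?SE"
      "(\<lambda>(R, a, b). insert (a, ?N) (insert (?N, b) R)) p =
        (\<lambda>(R, a, b). insert (a, ?N) (insert (?N, b) R)) q"
    obtain R a b R' a' b' where p: "p = (R, a, b)" and q: "q = (R', a', b')"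
      by (metis prod_cases3)
    have R: "R \<in> partial_injs k n (Suc h)" "R' \<in> partial_injs k n (Suc h)"
      and eq: "insert (a, ?N) (insert (?N, b) R) = insert (a', ?N) (insert (?N, b') R')"
      and ab: "a \<in> {1..n}" "b \<in> {1..n}" "a' \<in> {1..n}" "b' \<in> {1..n}"
      using pq unfolding p q by simp_all
    have "(a, ?N) \<in> insert (a', ?N) (insert (?N, b') R')"
      "(?N, b) \<in> insert (a', ?N) (insert (?N, b') R')"
      using eq by blast+
    then have "a = a'" "b = b'" using ab old[OF R(2)] by auto
    moreover have "R = R'"
      using restr[OF R(1), of "(a, ?N)" "(?N, b)"] restr[OF R(2), of "(a', ?N)" "(?N, b')"] eq by simp
    ultimately show "p = q" by (simp add: p q)
  qed
  then have "card ?E = card ?SE" by (rule card_image)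
  also have "\<dots> = (h + 1)\<^sup>2 * card (partial_injs k n (Suc h))"
    by (subst card_SigmaI)
      (auto simp: finite_partial_injs partial_injs_deficit card_cartesian_product power2_eq_square
        algebra_simps simp del: One_nat_def)
  finally have cE: "card ?E = (h + 1)\<^sup>2 * card (partial_injs k n (Suc h))" .
  have pA: "?N \<notin> fst ` R \<and> ?N \<notin> snd ` R" if "R \<in> ?A" for R
    using that old by (force split: if_splits)
  have pB: "(?N, ?N) \<in> R" if "R \<in> ?B" for R
    using that by blast
  have pC: "?N \<in> fst ` R \<and> ?N \<notin> snd ` R" if "R \<in> ?C" for R
    using that old by force
  have pD: "?N \<notin> fst ` R \<and> ?N \<in> snd ` R" if "R \<in> ?D" for R
    using that old by force
  have pE: "?N \<in> fst ` R \<and> ?N \<in> snd ` R \<and> (?N, ?N) \<notin> R" if "R \<in> ?E" for R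
    using that old by force
  have pB': "?N \<in> fst ` R \<and> ?N \<in> snd ` R \<and> (?N, ?N) \<in> R" if "R \<in> ?B" for R
    using pB[OF that] by force
  have "card (partial_injs k ?N h) = card ?A + card ?B + card ?C + card ?D + card ?E"
    unfolding partial_injs_Suc[OF assms]
    by (rule card_Un_five[where P = "\<lambda>R. ?N \<in> fst ` R" and Q = "\<lambda>R. ?N \<in> snd ` R"
          and T = "\<lambda>R. (?N, ?N) \<in> R"]) (fact fin pA pB' pC pD pE)+
  then show ?thesis
    unfolding cB cC cD cE by (simp add: algebra_simps)
qed

section \<open>Permutations as partial injections of height 0\<close>

text \<open>A permutation corresponds to its graph. Conversely, at height 0 no point lacks an image,
  so the relation is the graph of an injective self-map of a finite set, hence of a
  permutation.\<close>

lemma card_bounded_excedance_perms: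
  "card (bounded_excedance_perms k n) = card (partial_injs k n 0)"
proof (rule bij_betw_same_card[of "\<lambda>\<pi>. (\<lambda>j. (j, \<pi> j)) ` {1..n}"], rule bij_betw_imageI)
  show "inj_on (\<lambda>\<pi>. (\<lambda>j. (j, \<pi> j)) ` {1..n}) (bounded_excedance_perms k n)"
  proof (rule inj_onI)
    fix \<pi> \<rho>
    assume *: "\<pi> \<in> bounded_excedance_perms k n" "\<rho> \<in> bounded_excedance_perms k n"
      "(\<lambda>j. (j, \<pi> j)) ` {1..n} = (\<lambda>j. (j, \<rho> j)) ` {1..n}"
    have "\<pi> j = \<rho> j" for j
    proof (cases "j \<in> {1..n}")
      case True
      then have "(j, \<pi> j) \<in> (\<lambda>j. (j, \<rho> j)) ` {1..n}" using *(3) by blast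
      then show ?thesis by auto
    next
      case False
      then show ?thesis
        using *(1,2) by (auto simp: bounded_excedance_perms_def permutes_not_in)
    qed
    then show "\<pi> = \<rho>" by blast
  qed
  have graph: "(\<lambda>j. (j, \<pi> j)) ` {1..n} \<in> partial_injs k n 0 \<longleftrightarrow> \<pi> \<in> bounded_excedance_perms k n"
    if \<pi>: "\<pi> permutes {1..n}" for \<pi>
  proof -
    let ?R = "(\<lambda>j. (j, \<pi> j)) ` {1..n}"
    \<comment> \<open>Each \<open>j\<close> in \<open>{1..i}\<close> has its value either in
      \<open>{1..i}\<close> or above \<open>i\<close>. So the number of unmatched points in the
      restricted graph is the excedance count at \<open>i\<close>.\<close>
    have prefix: "card (?R \<inter> {1..i} \<times> {1..i}) + card {j \<in> {1..n}. j \<le> i \<and> \<pi> j > i} = i"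
      if "i \<le> n" for i
    proof -
      let ?X = "{j \<in> {1..i}. \<pi> j \<le> i}" and ?Y = "{j \<in> {1..n}. j \<le> i \<and> \<pi> j > i}"
      have "?R \<inter> {1..i} \<times> {1..i} = (\<lambda>j. (j, \<pi> j)) ` ?X"
        using that permutes_in_image[OF \<pi>] by force
      then have "card (?R \<inter> {1..i} \<times> {1..i}) = card ?X"
        by (simp add: card_image inj_on_def)
      moreover have "card ?X + card ?Y = card (?X \<union> ?Y)"
        by (rule card_Un_disjoint[symmetric]) auto
      moreover have "?X \<union> ?Y = {1..i}" using that by auto
      ultimately show ?thesis by simp
    qed
    have "?R \<subseteq> {1..n} \<times> {1..n}" using permutes_in_image[OF \<pi>] by blast
    moreover have "inj_on fst ?R" by (auto simp: inj_on_def)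
    moreover have "inj_on snd ?R"
      using permutes_inj_on[OF \<pi>] by (intro inj_on_imageI) (simp add: comp_def)
    moreover have "card ?R = n" by (simp add: card_image inj_on_def)
    moreover have "(\<forall>i\<le>n. i \<le> card (?R \<inter> {1..i} \<times> {1..i}) + k) \<longleftrightarrow>
        (\<forall>i\<in>{1..n}. card {j \<in> {1..n}. j \<le> i \<and> \<pi> j > i} \<le> k)" (is "?P \<longleftrightarrow> ?Q")
    proof
      assume P: ?P
      show ?Q
      proof
        fix i assume "i \<in> {1..n}"
        then show "card {j \<in> {1..n}. j \<le> i \<and> \<pi> j > i} \<le> k"
          using prefix[of i] P[rule_format, of i] by simp
      qed
    next
      assume Q: ?Q
      show ?P
      proof (intro allI impI)
        fix i assume i: "i \<le> n"
        \<comment> \<open>The prefix condition includes the trivial case \<open>i = 0\<close>; the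
          excedance bound starts at \<open>i = 1\<close>.\<close>
        show "i \<le> card (?R \<inter> {1..i} \<times> {1..i}) + k"
        proof (cases "i = 0")
          case False
          then have "card {j \<in> {1..n}. j \<le> i \<and> \<pi> j > i} \<le> k" using Q i by simp
          then show ?thesis using prefix[OF i] by linarith
        qed simp
      qed
    qed
    ultimately show ?thesis
      using \<pi> unfolding partial_injs_def bounded_excedance_perms_def by simp
  qed
  show "(\<lambda>\<pi>. (\<lambda>j. (j, \<pi> j)) ` {1..n}) ` bounded_excedance_perms k n = partial_injs k n 0"
  proof
    show "(\<lambda>\<pi>. (\<lambda>j. (j, \<pi> j)) ` {1..n}) ` bounded_excedance_perms k n \<subseteq> partial_injs k n 0"
      using graph by (auto simp: bounded_excedance_perms_def)
    show "partial_injs k n 0 \<subseteq> (\<lambda>\<pi>. (\<lambda>j. (j, \<pi> j)) ` {1..n}) ` bounded_excedance_perms k n"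
    proof
      fix R assume R: "R \<in> partial_injs k n 0"
      then have sub: "R \<subseteq> {1..n} \<times> {1..n}" and inj: "inj_on fst R" "inj_on snd R"
        by (auto simp: partial_injs_def)
      have fst: "fst ` R = {1..n}"
        using partial_injs_deficit(1)[OF R] sub by force
      \<comment> \<open>The identity outside \<open>{1..n}\<close> is what \<open>permutes\<close>
        demands.\<close>
      define \<pi> where "\<pi> j = (if j \<in> {1..n} then THE b. (j, b) \<in> R else j)" for j
      have \<pi>R: "(j, \<pi> j) \<in> R" if j: "j \<in> {1..n}" for j
      proof -
        obtain b where "(j, b) \<in> R" using fst j by force
        then have "\<exists>!b. (j, b) \<in> R" using inj_onD[OF inj(1)] by fastforce
        then show ?thesis using theI'[of "\<lambda>b. (j, b) \<in> R"] j by (simp add: \<pi>_def)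
      qed
      have eq: "(\<lambda>j. (j, \<pi> j)) ` {1..n} = R"
      proof
        show "(\<lambda>j. (j, \<pi> j)) ` {1..n} \<subseteq> R" using \<pi>R by blast
        show "R \<subseteq> (\<lambda>j. (j, \<pi> j)) ` {1..n}"
        proof
          fix p assume p: "p \<in> R"
          then have "fst p \<in> {1..n}" using sub by auto
          moreover from this have "p = (fst p, \<pi> (fst p))"
            using inj_onD[OF inj(1) _ p \<pi>R] by simp
          ultimately show "p \<in> (\<lambda>j. (j, \<pi> j)) ` {1..n}" by blast
        qed
      qed
      have "inj_on \<pi> {1..n}"
      proof (rule inj_onI)
        fix i j assume "i \<in> {1..n}" "j \<in> {1..n}" "\<pi> i = \<pi> j"
        then show "i = j" using inj_onD[OF inj(2) _ \<pi>R \<pi>R, of i j] by simp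
      qed
      moreover have "\<pi> ` {1..n} \<subseteq> {1..n}" using \<pi>R sub by blast
      ultimately have "bij_betw \<pi> {1..n} {1..n}"
        by (simp add: bij_betw_def endo_inj_surj)
      then have "\<pi> permutes {1..n}"
        by (rule bij_imp_permutes) (auto simp: \<pi>_def)
      then have "\<pi> \<in> bounded_excedance_perms k n" using graph[of \<pi>] eq R by simp
      then show "R \<in> (\<lambda>\<pi>. (\<lambda>j. (j, \<pi> j)) ` {1..n}) ` bounded_excedance_perms k n"
        using eq by blast
    qed
  qed
qed

text \<open>The convention for \<open>n = 0\<close> agrees with the count: the empty relation is the
  only partial injection, and it has height 0.\<close>

lemma a_num_eq: "a_num k n = card (partial_injs k n 0)"
  by (simp add: a_num_def card_bounded_excedance_perms partial_injs_0)

section \<open>Generating functions and the continued fraction\<close>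

definition partial_injs_gf :: "nat \<Rightarrow> nat \<Rightarrow> rat fps" where
  "partial_injs_gf k h = Abs_fps (\<lambda>n. of_nat (card (partial_injs k n h)))"

text \<open>In positive degree this is the one-step recurrence, each step contributing a factor
  \<open>fps_X\<close>. The summand 1 at \<open>h = 0\<close> stands for the empty path.\<close>

lemma partial_injs_gf_rec:
  assumes "h \<le> k"
  shows "partial_injs_gf k h = (if h = 0 then 1 else fps_X * partial_injs_gf k (h - 1)) +
    of_nat (2 * h + 1) * fps_X * partial_injs_gf k h + of_nat ((h + 1)\<^sup>2) * fps_X * partial_injs_gf k (h + 1)"
proof (rule fps_ext)
  fix n
  have nth: "fps_nth (of_nat c * fps_X * F) m = of_nat c * (if m = 0 then 0 else fps_nth F (m - 1))"
    for c m and F :: "rat fps"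
    by (simp add: mult.assoc fps_of_nat[symmetric])
  show "fps_nth (partial_injs_gf k h) n = fps_nth ((if h = 0 then 1 else fps_X * partial_injs_gf k (h - 1)) +
    of_nat (2 * h + 1) * fps_X * partial_injs_gf k h + of_nat ((h + 1)\<^sup>2) * fps_X * partial_injs_gf k (h + 1)) n"
  proof (cases n)
    case 0
    then show ?thesis by (simp only: fps_add_nth nth) (simp add: partial_injs_gf_def partial_injs_0)
  next
    case (Suc m)
    then show ?thesis
      by (simp only: fps_add_nth nth) (simp add: partial_injs_gf_def card_partial_injs_Suc[OF assms] distrib_right)
  qed
qed

lemma partial_injs_gf_zero_above: "k < h \<Longrightarrow> partial_injs_gf k h = 0"
  by (simp add: partial_injs_gf_def partial_injs_empty_above fps_eq_iff)

text \<open>The quotient in the recursion has a factor \<open>fps_X\<^sup>2\<close> and, by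
  induction, a unit as denominator, so its constant coefficient is 0. Dividing by a tail is
  therefore multiplying by its inverse.\<close>

lemma cf_tail_nth_0: "fps_nth (cf_tail k h) 0 = 1"
proof (induction k h rule: cf_tail.induct)
  case (1 k h)
  show ?case
  proof (cases "h < k")
    case True
    then have "fps_nth (of_nat ((h + 1)\<^sup>2) * fps_X\<^sup>2 / cf_tail k (h + 1)) 0 = 0"
      using 1 by (simp add: fps_divide_unit)
    then show ?thesis using True by (subst cf_tail.simps) simp
  next
    case False
    then show ?thesis by (subst cf_tail.simps) simp
  qed
qed

text \<open>The claim for \<open>h + 1\<close> turns the falling term of the recurrence into a
  multiple of \<open>W\<^sub>h\<close>; the collected factor of \<open>W\<^sub>h\<close> is then the
  tail at \<open>h\<close>. The claim is a product because \<open>W\<^sub>h\<close> with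
  \<open>h > 0\<close> has constant coefficient 0 and is not a unit.\<close>

lemma cf_tail_mult_partial_injs_gf:
  "h \<le> k \<Longrightarrow> cf_tail k h * partial_injs_gf k h = (if h = 0 then 1 else fps_X * partial_injs_gf k (h - 1))"
proof (induction k h rule: cf_tail.induct)
  case (1 k h)
  let ?b = "if h = 0 then 1 else fps_X * partial_injs_gf k (h - 1)"
  have rec: "(1 - of_nat (2 * h + 1) * fps_X) * partial_injs_gf k h
      - of_nat ((h + 1)\<^sup>2) * fps_X * partial_injs_gf k (h + 1) = ?b"
    using partial_injs_gf_rec[OF 1(2)] by (simp add: algebra_simps)
  show ?case
  proof (cases "h < k")
    case True
    let ?C = "cf_tail k (h + 1)"
    have IH: "?C * partial_injs_gf k (h + 1) = fps_X * partial_injs_gf k h"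
      using 1(1)[OF True] True by simp
    have inv: "inverse ?C * ?C = 1"
      by (rule inverse_mult_eq_1) (simp add: cf_tail_nth_0)
    have "fps_X\<^sup>2 / ?C * partial_injs_gf k h = fps_X * inverse ?C * (fps_X * partial_injs_gf k h)"
      by (simp add: fps_divide_unit cf_tail_nth_0 power2_eq_square mult_ac)
    also have "\<dots> = fps_X * (inverse ?C * ?C) * partial_injs_gf k (h + 1)"
      unfolding IH[symmetric] by (simp only: mult_ac)
    finally have q: "fps_X\<^sup>2 / ?C * partial_injs_gf k h = fps_X * partial_injs_gf k (h + 1)"
      unfolding inv by simp
    have "cf_tail k h * partial_injs_gf k h = (1 - of_nat (2 * h + 1) * fps_X) * partial_injs_gf k h
        - of_nat ((h + 1)\<^sup>2) * (fps_X\<^sup>2 / ?C * partial_injs_gf k h)"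
      using True by (subst cf_tail.simps)
        (simp add: fps_divide_unit cf_tail_nth_0 left_diff_distrib mult.assoc)
    then show ?thesis unfolding q using rec by (simp add: mult.assoc)
  next
    case False
    \<comment> \<open>Here \<open>h = k\<close>: no partial injection has height
      \<open>k + 1\<close>, so the falling term vanishes and the recurrence is already the claim for
      the last tail.\<close>
    then have "partial_injs_gf k (h + 1) = 0" by (simp add: partial_injs_gf_zero_above)
    then show ?thesis using rec False by (subst cf_tail.simps) simp
  qed
qed

theorem theorem5p5:
  fixes k :: nat
  shows "A_gf k = 1 / cf_tail k 0"
proof -
  have "A_gf k = partial_injs_gf k 0" by (simp add: A_gf_def partial_injs_gf_def a_num_eq)
  \<comment> \<open>At \<open>h = 0\<close> the right-hand side is 1, so \<open>W\<^sub>0\<close> is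
    the inverse of the unit \<open>cf_tail k 0\<close>.\<close>
  moreover have "cf_tail k 0 * partial_injs_gf k 0 = 1" using cf_tail_mult_partial_injs_gf[of 0 k] by simp
  ultimately show ?thesis
    by (metis cf_tail_nth_0 fps_divide_unit fps_inverse_unique mult_1 one_neq_zero)
qed

end
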